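(* Let $L$ be an irreducible almost lower-triangular transition matrix on $\mathbb N$. For $n\ge0$ let $L^{(n)}$ be the projected transition matrix on $[0,n]$ defined by $$L^{(n)}_{i,j}=L_{i,j}\ \ (0\le i\le n,\ 0\le j\le n-1),\qquad L^{(n)}_{i,n}=\sum_{j\ge n}L_{i,j}\ \ (0\le i\le n),$$ and let $\rho^{(n)}$ be the invariant probability distribution of $L^{(n)}$. If $\rho^{(n)}$ converges weakly to some probability measure $\rho$ on $\mathbb N$, then $\rho$ is invariant by $L$.
   Context: $\mathbb N=\{0,1,2,\dots\}$, $[0,n]=\{0,\dots,n\}$. A transition matrix $L=[L_{i,j}]_{i,j\ge0}$ on $\mathbb N$ (non-negative entries, rows summing to $1$) is almost lower-triangular if $L_{i,j}>0\Rightarrow j\le i+1$. A measure $\rho$ is invariant by $L$ if $\sum_a\rho_aL_{a,b}=\rho_b$ for all $b$. Weak convergence $\rho^{(n)}\to\rho$ means $\rho^{(n)}_k\to\rho_k$ for every $k\ge0$, measures on $[0,n]$ being viewed as measures on $\mathbb N$ (zero outside $[0,n]$). Unless otherwise stated, all Markov chains on $\mathbb N$ are irreducible. *)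

theory Defs
  imports "HOL-Probability.Probability_Mass_Function" "HOL-Analysis.Infinite_Sum"
begin

text \<open>
  Matrices indexed by a set \<open>S\<close> of states are functions \<open>nat \<Rightarrow> nat \<Rightarrow> real\<close> of which only the
  entries in \<open>S \<times> S\<close> matter. The state space is \<open>UNIV\<close> for chains on the natural numbers
  and \<open>{..n}\<close> for chains on \<open>[0,n]\<close>.
\<close>

definition transition_matrix :: "nat set \<Rightarrow> (nat \<Rightarrow> nat \<Rightarrow> real) \<Rightarrow> bool" where
  "transition_matrix S L \<longleftrightarrow>
     (\<forall>i\<in>S. \<forall>j\<in>S. 0 \<le> L i j) \<and> (\<forall>i\<in>S. (L i has_sum 1) S)"

primrec mat_power :: "nat set \<Rightarrow> (nat \<Rightarrow> nat \<Rightarrow> real) \<Rightarrow> nat \<Rightarrow> nat \<Rightarrow> nat \<Rightarrow> real" where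
  "mat_power S L 0 i j = (if i = j then 1 else 0)"
| "mat_power S L (Suc m) i j = (\<Sum>\<^sub>\<infinity>k\<in>S. L i k * mat_power S L m k j)"

definition irreducible_matrix :: "nat set \<Rightarrow> (nat \<Rightarrow> nat \<Rightarrow> real) \<Rightarrow> bool" where
  "irreducible_matrix S L \<longleftrightarrow> (\<forall>i\<in>S. \<forall>j\<in>S. \<exists>m. 0 < mat_power S L m i j)"

definition almost_lower_triangular :: "(nat \<Rightarrow> nat \<Rightarrow> real) \<Rightarrow> bool" where
  "almost_lower_triangular L \<longleftrightarrow> (\<forall>i j. 0 < L i j \<longrightarrow> j \<le> i + 1)"

definition projected_matrix :: "(nat \<Rightarrow> nat \<Rightarrow> real) \<Rightarrow> nat \<Rightarrow> nat \<Rightarrow> nat \<Rightarrow> real" where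
  "projected_matrix L n i j =
     (if i \<le> n \<and> j < n then L i j
      else if i \<le> n \<and> j = n then (\<Sum>\<^sub>\<infinity>k\<in>{n..}. L i k)
      else 0)"

text \<open>A measure on \<open>S\<close> with finite point masses is given by its mass function.\<close>

definition invariant_measure :: "nat set \<Rightarrow> (nat \<Rightarrow> nat \<Rightarrow> real) \<Rightarrow> (nat \<Rightarrow> real) \<Rightarrow> bool" where
  "invariant_measure S L \<rho> \<longleftrightarrow>
     (\<forall>a\<in>S. 0 \<le> \<rho> a) \<and> (\<forall>b\<in>S. ((\<lambda>a. \<rho> a * L a b) has_sum \<rho> b) S)"

text \<open>
  A probability distribution on \<open>S\<close> is viewed as a distribution on the natural numbers that
  vanishes outside \<open>S\<close>.
\<close>

definition invariant_distribution :: "nat set \<Rightarrow> (nat \<Rightarrow> nat \<Rightarrow> real) \<Rightarrow> nat pmf \<Rightarrow> bool" where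
  "invariant_distribution S L \<rho> \<longleftrightarrow> set_pmf \<rho> \<subseteq> S \<and> invariant_measure S L (pmf \<rho>)"

definition weakly_converges :: "(nat \<Rightarrow> nat pmf) \<Rightarrow> nat pmf \<Rightarrow> bool" where
  "weakly_converges \<rho>s \<rho> \<longleftrightarrow> (\<forall>k. (\<lambda>n. pmf (\<rho>s n) k) \<longlonglongrightarrow> pmf \<rho> k)"

end

theory Submission imports Defs begin

text \<open>
  Fix a state \<open>b\<close>. For \<open>n > b\<close> the column \<open>b\<close> of the projected matrix agrees with that of \<open>L\<close> on
  the rows \<open>0, \<dots>, n\<close>, which carry the whole mass of \<open>\<rho>s n\<close>. So \<open>pmf (\<rho>s n) b\<close> is the expectation
  of the function \<open>\<lambda>a. L a b\<close> under \<open>\<rho>s n\<close>. This function takes its values in \<open>[0,1]\<close>, and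
  expectations of bounded functions pass to the limit because the limit \<open>\<rho>\<close> is a probability
  measure: no mass escapes to infinity. The limiting identity is the invariance of \<open>\<rho>\<close> at \<open>b\<close>.

  For the passage to the limit (\<open>has_sum_pmf_limit\<close>), Fatou's lemma applied to \<open>f\<close> bounds
  the expectation of \<open>f\<close> under \<open>\<rho>\<close> from above by the limit of the expectations; applied to \<open>1 - f\<close>, it gives the bound
  from below, since the total mass \<open>1\<close> is the same before and after the limit.
\<close>

lemma has_sum_pmf_UNIV: "(pmf p has_sum 1) UNIV"
proof -
  have "pmf p summable_on UNIV"
    using pmf_abs_summable[of p UNIV] by (simp flip: abs_summable_equivalent)
  moreover have "infsum (pmf p) UNIV = 1"
    using infsetsum_infsum[OF pmf_abs_summable, of p UNIV] infsetsum_pmf_eq_1[of p UNIV] by simp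
  ultimately show ?thesis by (simp add: has_sum_iff)
qed

text \<open>
  Fatou's lemma for sums against probability mass functions: the bound on the expectations applies
  to every finite partial sum, where the limit can be taken termwise.
\<close>

lemma pmf_limit_Fatou:
  fixes f :: "nat \<Rightarrow> real"
  assumes conv: "weakly_converges \<rho>s \<rho>"
    and nonneg: "\<And>a. 0 \<le> f a"
    and sums: "eventually (\<lambda>n. ((\<lambda>a. pmf (\<rho>s n) a * f a) has_sum c n) UNIV) sequentially"
    and lim: "c \<longlonglongrightarrow> l"
  shows "(\<lambda>a. pmf \<rho> a * f a) summable_on UNIV" and "(\<Sum>\<^sub>\<infinity>a. pmf \<rho> a * f a) \<le> l"
proof -
  have bound: "(\<Sum>a\<in>F. pmf \<rho> a * f a) \<le> l" if "finite F" for F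
  proof (rule tendsto_le[OF sequentially_bot lim])
    show "(\<lambda>n. \<Sum>a\<in>F. pmf (\<rho>s n) a * f a) \<longlonglongrightarrow> (\<Sum>a\<in>F. pmf \<rho> a * f a)"
      using conv unfolding weakly_converges_def by (intro tendsto_intros) auto
    show "eventually (\<lambda>n. (\<Sum>a\<in>F. pmf (\<rho>s n) a * f a) \<le> c n) sequentially"
      using sums
      by eventually_elim (rule finite_sum_le_has_sum, use that nonneg in auto)
  qed
  show summable: "(\<lambda>a. pmf \<rho> a * f a) summable_on UNIV"
    by (rule nonneg_bdd_above_summable_on) (use nonneg bound in \<open>auto intro!: bdd_aboveI\<close>)
  show "(\<Sum>\<^sub>\<infinity>a. pmf \<rho> a * f a) \<le> l"
    by (rule infsum_le_finite_sums[OF summable]) (use bound in auto)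
qed

lemma has_sum_pmf_limit:
  fixes f :: "nat \<Rightarrow> real"
  assumes conv: "weakly_converges \<rho>s \<rho>"
    and f: "\<And>a. 0 \<le> f a" "\<And>a. f a \<le> 1"
    and sums: "eventually (\<lambda>n. ((\<lambda>a. pmf (\<rho>s n) a * f a) has_sum c n) UNIV) sequentially"
    and lim: "c \<longlonglongrightarrow> l"
  shows "((\<lambda>a. pmf \<rho> a * f a) has_sum l) UNIV"
proof -
  let ?e = "\<Sum>\<^sub>\<infinity>a. pmf \<rho> a * f a"
  have compl: "((\<lambda>a. pmf p a * (1 - f a)) has_sum (1 - s)) UNIV"
    if "((\<lambda>a. pmf p a * f a) has_sum s) UNIV" for p s
    using has_sum_add[OF has_sum_pmf_UNIV[of p] has_sum_uminusI[OF that]]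
    by (simp add: right_diff_distrib)
  note upper = pmf_limit_Fatou[OF conv f(1) sums lim]
  have e: "((\<lambda>a. pmf \<rho> a * f a) has_sum ?e) UNIV"
    using upper(1) by (rule has_sum_infsum)
  have "eventually (\<lambda>n. ((\<lambda>a. pmf (\<rho>s n) a * (1 - f a)) has_sum (1 - c n)) UNIV) sequentially"
    using sums by eventually_elim (rule compl)
  moreover have "(\<lambda>n. 1 - c n) \<longlonglongrightarrow> 1 - l"
    using lim by (intro tendsto_intros)
  ultimately have "(\<Sum>\<^sub>\<infinity>a. pmf \<rho> a * (1 - f a)) \<le> 1 - l"
    using f(2) by (intro pmf_limit_Fatou(2)[OF conv]) auto
  then have "1 - ?e \<le> 1 - l"
    by (simp add: infsumI[OF compl[OF e]])
  with upper(2) have "?e = l" by simp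
  with e show ?thesis by simp
qed

lemma transition_matrix_le_1:
  assumes "transition_matrix UNIV L"
  shows "L i j \<le> 1"
proof -
  have "sum (L i) {j} \<le> 1"
    by (rule finite_sum_le_has_sum[where A = UNIV])
      (use assms in \<open>auto simp: transition_matrix_def\<close>)
  then show ?thesis by simp
qed

lemma projected_invariant_has_sum:
  assumes inv: "invariant_distribution {..n} (projected_matrix L n) p" and "b < n"
  shows "((\<lambda>a. pmf p a * L a b) has_sum pmf p b) UNIV"
proof -
  have "((\<lambda>a. pmf p a * projected_matrix L n a b) has_sum pmf p b) {..n}"
    using assms by (auto simp: invariant_distribution_def invariant_measure_def)
  moreover have "pmf p a = 0" if "n < a" for a
    using inv that by (auto simp: invariant_distribution_def set_pmf_iff)
  ultimately show ?thesis
    using \<open>b < n\<close>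
    by (subst has_sum_cong_neutral[where T = "{..n}"
          and g = "\<lambda>a. pmf p a * projected_matrix L n a b"])
      (auto simp: projected_matrix_def)
qed

theorem proposition2p18:
  fixes L :: "nat \<Rightarrow> nat \<Rightarrow> real" and \<rho>s :: "nat \<Rightarrow> nat pmf" and \<rho> :: "nat pmf"
  assumes "transition_matrix UNIV L"
    and "irreducible_matrix UNIV L"
    and "almost_lower_triangular L"
    and "\<And>n. invariant_distribution {..n} (projected_matrix L n) (\<rho>s n)"
    and "weakly_converges \<rho>s \<rho>"
  shows "invariant_measure UNIV L (pmf \<rho>)"
proof -
  have "((\<lambda>a. pmf \<rho> a * L a b) has_sum pmf \<rho> b) UNIV" for b
  proof (rule has_sum_pmf_limit[OF assms(5)])
    show "0 \<le> L a b" for a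
      using assms(1) by (simp add: transition_matrix_def)
    show "L a b \<le> 1" for a
      using assms(1) by (rule transition_matrix_le_1)
    show "eventually (\<lambda>n. ((\<lambda>a. pmf (\<rho>s n) a * L a b) has_sum pmf (\<rho>s n) b) UNIV) sequentially"
      using eventually_gt_at_top[of b]
      by eventually_elim (rule projected_invariant_has_sum[OF assms(4)])
    show "(\<lambda>n. pmf (\<rho>s n) b) \<longlonglongrightarrow> pmf \<rho> b"
      using assms(5) by (simp add: weakly_converges_def)
  qed
  then show ?thesis by (simp add: invariant_measure_def)
qed

end
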